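(* Let $q$ be a prime power, let $r$ be a positive integer, and let $\mathcal C_X$ and $\mathcal C_Z$ be $[n,k_X,d_X]_q$ and $[n,k_Z,d_Z]_q$ linear codes, respectively, such that for every $i\in[n]$ there exist $\mathbf h_i^X\in\mathcal C_X^\perp$ and $\mathbf h_i^Z\in\mathcal C_Z^\perp$ with $i\in\mathrm{supp}(\mathbf h_i^X)\cap\mathrm{supp}(\mathbf h_i^Z)$ and $|\mathrm{supp}(\mathbf h_i^X)\cup\mathrm{supp}(\mathbf h_i^Z)|\le r+1$. Suppose that the resulting $[[n,\kappa,\delta;c]]_q$ CSS-like EAQLRC $\mathcal Q(\mathcal C_X,\mathcal C_Z)$ of locality $r$ is pure. Then $\mathcal Q(\mathcal C_X,\mathcal C_Z)$ is optimal with respect to the Singleton-like bound, i.e. $$2\delta=n+c-\kappa-2\left\lceil\frac{\kappa}{r}\right\rceil+4,$$ if and only if the following three conditions hold: 1) $\mathcal C_X$ and $\mathcal C_Z$ have the same parameters (i.e. $k_X=k_Z$ and $d_X=d_Z$); 2) both $\mathcal C_X$ and $\mathcal C_Z$ are optimal classical locally recoverable codes meeting the classical Singleton-like bound, i.e. $d_X=n-k_X-\lceil k_X/r\rceil+2$ and $d_Z=n-k_Z-\lceil k_Z/r\rceil+2$; 3) $\left\lceil\frac{k_X}{r}\right\rceil=\left\lceil\frac{k_Z}{r}\right\rceil=\left\lceil\frac{\kappa}{r}\right\rceil$.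
   Context: Notation. $[m]=\{1,\dots,m\}$. An $[n,k,d]_q$ linear code is a $k$-dimensional subspace of $\mathbb F_q^n$ with minimum distance $d$; $\mathcal C^\perp$ is the Euclidean dual; $\mathrm{supp}(\mathbf u)=\{i:u_i\neq0\}$; for a set $S\subseteq\mathbb F_q^n$ containing a nonzero vector, $\mathrm{wt}(S)$ is the minimum Hamming weight of its nonzero vectors. Parameters of $\mathcal Q(\mathcal C_X,\mathcal C_Z)$. The EA-CSS code $\mathcal Q(\mathcal C_X,\mathcal C_Z)$ built from $\mathcal C_X,\mathcal C_Z$ has parameters $[[n,\kappa,\delta;c]]_q$ ($n$ transmitted qudits, $\kappa$ logical qudits, minimum distance $\delta$, $c$ maximally entangled pairs), where $$c=n-k_X-\dim(\mathcal C_X^\perp\cap\mathcal C_Z)=n-k_Z-\dim(\mathcal C_X\cap\mathcal C_Z^\perp),\qquad\kappa=k_X+k_Z-n+c,$$ and $\delta=\min\{d_X,d_Z\}$ if $\mathcal C_X\subseteq\mathcal C_Z^\perp$, and otherwise $\delta=\min\{\mathrm{wt}(\mathcal C_X\setminus(\mathcal C_X\cap\mathcal C_Z^\perp)),\ \mathrm{wt}(\mathcal C_Z\setminus(\mathcal C_X^\perp\cap\mathcal C_Z))\}$. It is called pure if $\delta=\min\{d_X,d_Z\}$. When the support condition in the claim holds, it is called a CSS-like EAQLRC of locality $r$. For completeness, the quantum code itself: with $q=p^m$, qudit basis $\{|x\rangle:x\in\mathbb F_q\}$, $X(a)|x\rangle=|x+a\rangle$, $Z(b)|x\rangle=e^{2\pi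 i\,{\rm tr}(bx)/p}|x\rangle$ (${\rm tr}:\mathbb F_q\to\mathbb F_p$ the trace), tensor products $X_A(\mathbf a),Z_A(\mathbf b)$ on a register $A$, parity-check matrices $\mathbf H_X,\mathbf H_Z$ of $\mathcal C_X,\mathcal C_Z$, and a rank factorization $-\mathbf H_X\mathbf H_Z^\top=\mathbf F_X\mathbf F_Z^\top$ where $\mathbf F_X,\mathbf F_Z$ have $c=\mathrm{rank}(\mathbf H_X\mathbf H_Z^\top)$ columns, $\mathcal Q(\mathcal C_X,\mathcal C_Z)$ is the subspace of $(\mathbb C^q)^{\otimes n}\otimes(\mathbb C^q)^{\otimes c}$ (transmitted register $Q$, noiseless receiver register $B$) fixed by all operators $X_Q(\mathbf u\mathbf H_X)Z_Q(\mathbf v\mathbf H_Z)\otimes X_B(\mathbf u\mathbf F_X)Z_B(\mathbf v\mathbf F_Z)$. Classical Singleton-like bound (known, Gopalan et al.): an $[n,k,d]_q$ linear code in which every symbol of a codeword can be recovered from at most $r$ other symbols satisfies $d\le n-k-\lceil k/r\rceil+2$. *)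

theory Defs
  imports "HOL-Analysis.Analysis" "HOL-Library.Function_Algebras"
    "HOL-Computational_Algebra.Computational_Algebra"
begin

section \<open>Linear codes\<close>

definition supp :: "('a::zero) ^ 'n::finite \<Rightarrow> 'n set" where
  "supp x = {i. x $ i \<noteq> 0}"

definition dotp :: "('a::comm_semiring_1) ^ 'n::finite \<Rightarrow> 'a ^ 'n \<Rightarrow> 'a" where
  "dotp x y = (\<Sum>i\<in>UNIV. x $ i * y $ i)"

definition dual :: "(('a::comm_semiring_1) ^ 'n::finite) set \<Rightarrow> ('a ^ 'n) set" where
  "dual C = {y. \<forall>x\<in>C. dotp x y = 0}"

definition hamming_dist :: "'a ^ 'n::finite \<Rightarrow> 'a ^ 'n \<Rightarrow> nat" where
  "hamming_dist x y = card {i. x $ i \<noteq> y $ i}"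

text \<open>\<open>min_dist C\<close> is meaningful only if \<open>C\<close> has two distinct elements, and \<open>min_wt S\<close> only
  if \<open>S\<close> contains a nonzero vector.\<close>

definition min_dist :: "(('a::finite) ^ 'n::finite) set \<Rightarrow> nat" where
  "min_dist C = Min {hamming_dist x y | x y. x \<in> C \<and> y \<in> C \<and> x \<noteq> y}"

definition min_wt :: "(('a::{zero,finite}) ^ 'n::finite) set \<Rightarrow> nat" where
  "min_wt S = Min {card (supp x) | x. x \<in> S \<and> x \<noteq> 0}"

text \<open>The field is \<open>'a\<close>, so \<open>q = CARD('a)\<close>; the length is \<open>CARD('n)\<close>.  The zero code has no
  minimum distance and hence is not an \<open>[n,k,d]\<close> code.\<close>

definition linear_code :: "(('a::{field,finite}) ^ 'n::finite) set \<Rightarrow> nat \<Rightarrow> nat \<Rightarrow> bool" where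
  "linear_code C k d \<longleftrightarrow> vec.subspace C \<and> C \<noteq> {0} \<and> vec.dim C = k \<and> min_dist C = d"

definition css_locality ::
    "nat \<Rightarrow> (('a::{field,finite}) ^ 'n::finite) set \<Rightarrow> ('a ^ 'n) set \<Rightarrow> bool" where
  "css_locality r C_X C_Z \<longleftrightarrow>
     (\<forall>i. \<exists>h_X\<in>dual C_X. \<exists>h_Z\<in>dual C_Z.
        i \<in> supp h_X \<inter> supp h_Z \<and> card (supp h_X \<union> supp h_Z) \<le> r + 1)"

section \<open>Vector spaces of functions\<close>

definition fun_scale :: "'k::field \<Rightarrow> ('i \<Rightarrow> 'k) \<Rightarrow> 'i \<Rightarrow> 'k" where
  "fun_scale a f = (\<lambda>i. a * f i)"

interpretation fun_vs: vector_space "fun_scale :: 'k::field \<Rightarrow> ('i \<Rightarrow> 'k) \<Rightarrow> 'i \<Rightarrow> 'k"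
  by unfold_locales (auto simp: fun_scale_def algebra_simps)

text \<open>Only the entries \<open>M i j\<close> with \<open>i < m\<close>, \<open>j < m'\<close> of a matrix \<open>M\<close> are relevant; its rank
  is the dimension of the row space.\<close>

definition mat_rank :: "nat \<Rightarrow> nat \<Rightarrow> (nat \<Rightarrow> nat \<Rightarrow> 'k::field) \<Rightarrow> nat" where
  "mat_rank m m' M =
     fun_vs.dim (fun_vs.span ((\<lambda>i j. if j < m' then M i j else 0) ` {..<m}))"

section \<open>Pauli operators\<close>

text \<open>The trace from \<open>'a\<close> to its prime field \<open>{of_nat t | t. t < CHAR('a)}\<close>.\<close>

definition field_deg :: "'a::{field,finite} itself \<Rightarrow> nat" where
  "field_deg _ = (THE m. CARD('a) = CHAR('a) ^ m)"

definition field_trace :: "'a::{field,finite} \<Rightarrow> 'a" where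
  "field_trace x = (\<Sum>i<field_deg TYPE('a). x ^ (CHAR('a) ^ i))"

definition add_char :: "'a::{field,finite} \<Rightarrow> complex" where
  "add_char x = cis (2 * pi * real (LEAST t. of_nat t = field_trace x) / real CHAR('a))"

text \<open>A basis state \<open>|x\<rangle>\<otimes>|y\<rangle>\<close> of the transmitted register \<open>Q\<close> and the receiver register \<open>B\<close>
  of \<open>c\<close> qudits is labelled by \<open>x\<close> and by \<open>y :: nat \<Rightarrow> 'a\<close> vanishing outside \<open>{..<c}\<close>; a state
  is its family of amplitudes.  With \<open>X(a)|x\<rangle> = |x + a\<rangle>\<close>, the amplitude of \<open>X(a) \<psi>\<close> at \<open>x\<close> is
  the amplitude of \<open>\<psi>\<close> at \<open>x - a\<close>.\<close>

type_synonym ('a, 'n) state = "('a ^ 'n) \<times> (nat \<Rightarrow> 'a) \<Rightarrow> complex"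

definition states :: "nat \<Rightarrow> ('a::{field,finite}, 'n::finite) state set" where
  "states c = {\<psi>. \<forall>x y. (\<exists>j\<ge>c. y j \<noteq> 0) \<longrightarrow> \<psi> (x, y) = 0}"

definition X_op :: "('a::{field,finite}) ^ 'n::finite \<Rightarrow> (nat \<Rightarrow> 'a) \<Rightarrow>
    ('a, 'n) state \<Rightarrow> ('a, 'n) state" where
  "X_op a a' \<psi> = (\<lambda>(x, y). \<psi> (x - a, y - a'))"

definition Z_op :: "nat \<Rightarrow> ('a::{field,finite}) ^ 'n::finite \<Rightarrow> (nat \<Rightarrow> 'a) \<Rightarrow>
    ('a, 'n) state \<Rightarrow> ('a, 'n) state" where
  "Z_op c b b' \<psi> = (\<lambda>(x, y).
     (\<Prod>i\<in>UNIV. add_char (b $ i * x $ i)) * (\<Prod>j<c. add_char (b' j * y j)) * \<psi> (x, y))"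

section \<open>The entanglement-assisted CSS code\<close>

text \<open>A matrix with \<open>m\<close> rows in \<open>'a ^ 'n\<close> is given by its rows \<open>H i\<close>, \<open>i < m\<close>.\<close>

definition parity_check_matrix ::
    "nat \<Rightarrow> (nat \<Rightarrow> ('a::{field,finite}) ^ 'n::finite) \<Rightarrow> ('a ^ 'n) set \<Rightarrow> bool" where
  "parity_check_matrix m H C \<longleftrightarrow>
     inj_on H {..<m} \<and> vec.independent (H ` {..<m}) \<and> C = {x. \<forall>i<m. dotp (H i) x = 0}"

definition rank_factorization ::
    "nat \<Rightarrow> nat \<Rightarrow> nat \<Rightarrow> (nat \<Rightarrow> nat \<Rightarrow> 'k::field) \<Rightarrow>
     (nat \<Rightarrow> nat \<Rightarrow> 'k) \<Rightarrow> (nat \<Rightarrow> nat \<Rightarrow> 'k) \<Rightarrow> bool" where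
  "rank_factorization m m' c M F G \<longleftrightarrow>
     c = mat_rank m m' M \<and> (\<forall>i<m. \<forall>j<m'. M i j = (\<Sum>l<c. F i l * G j l))"

definition row_comb ::
    "nat \<Rightarrow> (nat \<Rightarrow> 'a) \<Rightarrow> (nat \<Rightarrow> ('a::{field,finite}) ^ 'n::finite) \<Rightarrow> 'a ^ 'n" where
  "row_comb m u H = (\<Sum>i<m. u i *s H i)"

definition row_comb_B ::
    "nat \<Rightarrow> nat \<Rightarrow> (nat \<Rightarrow> 'a::{field,finite}) \<Rightarrow> (nat \<Rightarrow> nat \<Rightarrow> 'a) \<Rightarrow> nat \<Rightarrow> 'a" where
  "row_comb_B m c u F = (\<lambda>l. if l < c then (\<Sum>i<m. u i * F i l) else 0)"

definition stabilized_space ::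
    "nat \<Rightarrow> nat \<Rightarrow> nat \<Rightarrow> (nat \<Rightarrow> ('a::{field,finite}) ^ 'n::finite) \<Rightarrow> (nat \<Rightarrow> 'a ^ 'n) \<Rightarrow>
     (nat \<Rightarrow> nat \<Rightarrow> 'a) \<Rightarrow> (nat \<Rightarrow> nat \<Rightarrow> 'a) \<Rightarrow> ('a, 'n) state set" where
  "stabilized_space m_X m_Z c H_X H_Z F_X F_Z =
     {\<psi> \<in> states c. \<forall>u v.
        X_op (row_comb m_X u H_X) (row_comb_B m_X c u F_X)
          (Z_op c (row_comb m_Z v H_Z) (row_comb_B m_Z c v F_Z) \<psi>) = \<psi>}"

text \<open>The code depends on the chosen parity-check matrices and rank factorization of
  \<open>- H_X H_Z\<^sup>T\<close>; \<open>ea_css_code C_X C_Z c Q\<close> says that \<open>Q\<close> arises from some such choice and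
  uses \<open>c\<close> maximally entangled pairs.\<close>

definition ea_css_code ::
    "(('a::{field,finite}) ^ 'n::finite) set \<Rightarrow> ('a ^ 'n) set \<Rightarrow> nat \<Rightarrow> ('a, 'n) state set \<Rightarrow> bool" where
  "ea_css_code C_X C_Z c Q \<longleftrightarrow>
     (\<exists>m_X m_Z H_X H_Z F_X F_Z.
        parity_check_matrix m_X H_X C_X \<and> parity_check_matrix m_Z H_Z C_Z \<and>
        rank_factorization m_X m_Z c (\<lambda>i j. - dotp (H_X i) (H_Z j)) F_X F_Z \<and>
        Q = stabilized_space m_X m_Z c H_X H_Z F_X F_Z)"

definition ea_css_distance ::
    "(('a::{field,finite}) ^ 'n::finite) set \<Rightarrow> ('a ^ 'n) set \<Rightarrow> nat" where
  "ea_css_distance C_X C_Z =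
     (if C_X \<subseteq> dual C_Z then min (min_dist C_X) (min_dist C_Z)
      else min (min_wt (C_X - (C_X \<inter> dual C_Z))) (min_wt (C_Z - (dual C_X \<inter> C_Z))))"

text \<open>\<open>Q\<close> is an EA-CSS code of \<open>C_X\<close> and \<open>C_Z\<close> with parameters \<open>[[CARD('n), \<kappa>, \<delta>; c]]\<close>;
  having \<open>\<kappa>\<close> logical qudits means having dimension \<open>q ^ \<kappa>\<close> over the complex numbers.\<close>

definition ea_css_code_params ::
    "(('a::{field,finite}) ^ 'n::finite) set \<Rightarrow> ('a ^ 'n) set \<Rightarrow> ('a, 'n) state set \<Rightarrow>
     nat \<Rightarrow> nat \<Rightarrow> nat \<Rightarrow> bool" where
  "ea_css_code_params C_X C_Z Q \<kappa> \<delta> c \<longleftrightarrow>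
     ea_css_code C_X C_Z c Q \<and> fun_vs.dim Q = CARD('a) ^ \<kappa> \<and> \<delta> = ea_css_distance C_X C_Z"

end

theory Submission
  imports Defs "HOL-Number_Theory.Cong"
begin

text \<open>
  A state is fixed by the \<open>Z\<close>-type stabilizers iff it is supported on the pairs \<open>(x, y)\<close> with
  \<open>H_Z x + F_Z y = 0\<close> (here one needs that the additive character is nontrivial), and by the
  \<open>X\<close>-type stabilizers iff it is invariant under translation by the pairs \<open>(u H_X, u F_X)\<close>.
  The code therefore has as dimension the number of cosets,
  \<open>q ^ (c + k_Z - (n - k_X))\<close>, so that \<open>\<kappa> = k_X + k_Z - n + c\<close>. Since \<open>c\<close> is the rank of an
  \<open>(n - k_X) \<times> (n - k_Z)\<close> matrix, \<open>\<kappa> \<le> k_X\<close> and \<open>\<kappa> \<le> k_Z\<close>. By the classical bound for both codes,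
  \<open>2 \<delta> \<le> d_X + d_Z \<le> 2 n - k_X - k_Z - \<lceil>k_X / r\<rceil> - \<lceil>k_Z / r\<rceil> + 4
    \<le> n + c - \<kappa> - 2 \<lceil>\<kappa> / r\<rceil> + 4\<close>,
  and the three conditions express equality throughout.
\<close>

section \<open>Counting in vector spaces over a finite field\<close>

text \<open>Induction on \<open>B\<close>: a new vector \<open>b\<close> outside the span makes each
  element of the larger span uniquely \<open>scale k b + y\<close> with \<open>y\<close> in the old
  span, so the cardinality is multiplied by \<open>q\<close>. This lets dimensions be compared by
  counting.\<close>

lemma (in vector_space) card_span_independent:
  assumes "finite (UNIV :: 'a set)" "finite B" "independent B"
  shows "finite (span B) \<and> card (span B) = CARD('a) ^ card B"
  using assms(2,3)
proof (induction B rule: finite_induct)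
  case (insert b B)
  then have b: "b \<notin> span B" and B: "independent B"
    using independent_insert[of b B] by auto
  define f where "f = (\<lambda>(k, y). scale k b + y)"
  have f_image: "span (insert b B) = f ` (UNIV \<times> span B)"
  proof (intro equalityI subsetI)
    fix x assume "x \<in> span (insert b B)"
    then obtain k where "x - scale k b \<in> span B"
      using span_breakdown_eq by blast
    then show "x \<in> f ` (UNIV \<times> span B)"
      by (intro image_eqI[of _ _ "(k, x - scale k b)"]) (auto simp: f_def)
  next
    fix x assume "x \<in> f ` (UNIV \<times> span B)"
    then obtain k y where "x = scale k b + y" "y \<in> span B"
      by (auto simp: f_def)
    then show "x \<in> span (insert b B)"
      using span_breakdown_eq[of x b B] by (auto intro: exI[of _ k])
  qed
  have "inj_on f (UNIV \<times> span B)"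
  proof (rule inj_onI, clarsimp simp: f_def)
    fix k y l z
    assume y: "y \<in> span B" and z: "z \<in> span B" and eq: "scale k b + y = scale l b + z"
    then have *: "scale (k - l) b = z - y"
      by (simp add: algebra_simps)
    have "k = l"
    proof (rule ccontr)
      assume "k \<noteq> l"
      then have "b = scale (inverse (k - l)) (z - y)"
        by (simp flip: *)
      then show False
        using b span_scale[OF span_diff[OF z y]] by metis
    qed
    then show "k = l \<and> y = z"
      using eq by simp
  qed
  then show ?case
    using insert.IH[OF B] insert.hyps assms(1)
    by (simp add: f_image card_image card_cartesian_product)
qed simp

lemma card_subspace:
  fixes V :: "(('a::{field,finite}) ^ 'n::finite) set"
  assumes "vec.subspace V"
  shows "card V = CARD('a) ^ vec.dim V"
proof -
  obtain B where "B \<subseteq> V" "vec.independent B" "V \<subseteq> vec.span B" "card B = vec.dim V"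
    using vec.basis_exists by blast
  moreover from this have "V = vec.span B"
    using assms vec.span_minimal by blast
  ultimately show ?thesis
    using vec.card_span_independent[of B] by simp
qed

lemma one_less_card_field: "1 < CARD('a::{field,finite})"
proof -
  have "card {0, 1 :: 'a} \<le> CARD('a)"
    by (intro card_mono) auto
  then show ?thesis by simp
qed

section \<open>The classical Singleton-like bound\<close>

text \<open>The code shortened at \<open>S\<close>, except that the zero coordinates are kept, so
  that all these subcodes live in the same space.\<close>

definition vanishing :: "('a::zero ^ 'n::finite) set \<Rightarrow> 'n set \<Rightarrow> ('a ^ 'n) set" where
  "vanishing C S = {x \<in> C. \<forall>i\<in>S. x $ i = 0}"

lemma vanishing_empty [simp]: "vanishing C {} = C"
  by (simp add: vanishing_def)

lemma subspace_vanishing: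
  "vec.subspace C \<Longrightarrow> vec.subspace (vanishing C S)"
  by (auto simp: vanishing_def vec.subspace_def)

text \<open>The nonempty fibres of the coordinate \<open>i\<close> on \<open>vanishing C S\<close>
  are translates of \<open>vanishing C (insert i S)\<close>, and there are at most \<open>q\<close>
  of them; counting turns this into a loss of at most one dimension.\<close>

lemma dim_vanishing_insert:
  fixes C :: "(('a::{field,finite}) ^ 'n::finite) set"
  assumes C: "vec.subspace C"
  shows "vec.dim (vanishing C S) \<le> vec.dim (vanishing C (insert i S)) + 1"
proof -
  let ?V = "vanishing C S" and ?W = "vanishing C (insert i S)"
  have fibre: "card {x \<in> ?V. x $ i = a} \<le> card ?W" for a
  proof (cases "{x \<in> ?V. x $ i = a} = {}")
    case False
    then obtain z where z: "z \<in> ?V" "z $ i = a" by auto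
    have "(\<lambda>x. x - z) ` {x \<in> ?V. x $ i = a} \<subseteq> ?W"
      using z vec.subspace_diff[OF C] by (auto simp: vanishing_def)
    then show ?thesis
      by (intro card_inj_on_le) (auto intro: inj_onI)
  next
    case True
    then show ?thesis by (simp only: card.empty)
  qed
  have "card ?V = card (\<Union>a\<in>UNIV. {x \<in> ?V. x $ i = a})"
    by (rule arg_cong[where f = card]) auto
  also have "\<dots> \<le> (\<Sum>a\<in>UNIV. card {x \<in> ?V. x $ i = a})"
    by (rule card_UN_le) simp
  also have "\<dots> \<le> CARD('a) * card ?W"
    using sum_bounded_above[of UNIV "\<lambda>a. card {x \<in> ?V. x $ i = a}" "card ?W"] fibre by simp
  finally have "CARD('a) ^ vec.dim ?V \<le> CARD('a) ^ (vec.dim ?W + 1)"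
    using C by (simp add: card_subspace subspace_vanishing)
  then show ?thesis
    using one_less_card_field power_le_imp_le_exp by blast
qed

lemma dim_vanishing_Un:
  fixes C :: "(('a::{field,finite}) ^ 'n::finite) set"
  assumes "vec.subspace C"
  shows "vec.dim (vanishing C S) \<le> vec.dim (vanishing C (S \<union> T)) + card T"
proof -
  have "finite T" by simp
  then show ?thesis
  proof (induction T rule: finite_induct)
    case (insert i T)
    then show ?case
      using dim_vanishing_insert[OF assms, of "S \<union> T" i] by simp
  qed simp
qed

text \<open>The parity check \<open>h\<close> expresses the coordinate \<open>i\<close> through
  coordinates in \<open>S\<close>, so its vanishing costs nothing.\<close>

lemma vanishing_dual_supp:
  fixes C :: "('a::field ^ 'n::finite) set"
  assumes "h \<in> dual C" "i \<in> supp h" "supp h - {i} \<subseteq> S"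
  shows "vanishing C (insert i S) = vanishing C S"
proof -
  have "x $ i = 0" if x: "x \<in> C" "\<forall>j\<in>S. x $ j = 0" for x
  proof -
    have "0 = dotp x h"
      using assms(1) x by (simp add: dual_def)
    also have "\<dots> = (\<Sum>j\<in>{i}. x $ j * h $ j)"
      unfolding dotp_def using x assms(3)
      by (intro sum.mono_neutral_right) (auto simp: supp_def subset_iff)
    finally show ?thesis
      using assms(2) by (simp add: supp_def)
  qed
  then show ?thesis
    by (auto simp: vanishing_def)
qed

lemma exists_vanishing_coordinate:
  fixes C :: "(('a::{field,finite}) ^ 'n::finite) set"
  assumes "vec.dim (vanishing C S) > 0"
  obtains x :: "'a ^ 'n" and i where "x \<in> vanishing C S" "x $ i \<noteq> 0" "i \<notin> S"
proof -
  have "\<not> vanishing C S \<subseteq> {0}"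
    using assms by (metis less_numeral_extra(3) vec.dim_eq_0)
  then obtain x where x: "x \<in> vanishing C S" "x \<noteq> 0" by auto
  then obtain i where "x $ i \<noteq> 0"
    by (auto simp: vec_eq_iff)
  with x that show thesis
    by (auto simp: vanishing_def)
qed

text \<open>Adding the support of a dual word of weight at most \<open>r + 1\<close> to \<open>S\<close> imposes at least one
  condition fewer than it adds coordinates, and at most \<open>r\<close> conditions.\<close>

lemma locality_vanishing:
  fixes C :: "(('a::{field,finite}) ^ 'n::finite) set"
  assumes C: "vec.subspace C" and "r > 0"
    and loc: "\<And>i. \<exists>h\<in>dual C. i \<in> supp h \<and> card (supp h) \<le> r + 1"
    and "t * r < vec.dim C"
  shows "\<exists>S. vec.dim C + t \<le> card S + vec.dim (vanishing C S) \<and>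
             vec.dim C \<le> vec.dim (vanishing C S) + t * r"
  using assms(4)
proof (induction t)
  case 0
  then show ?case by (intro exI[of _ "{}"]) simp
next
  case (Suc t)
  then obtain S where S: "vec.dim C + t \<le> card S + vec.dim (vanishing C S)"
      "vec.dim C \<le> vec.dim (vanishing C S) + t * r"
    by auto
  with Suc.prems have "vec.dim (vanishing C S) > 0" by simp
  then obtain x i where i: "i \<notin> S"
    using exists_vanishing_coordinate by blast
  obtain h where h: "h \<in> dual C" "i \<in> supp h" "card (supp h) \<le> r + 1"
    using loc by blast
  define T where "T = supp h - {i} - S"
  have "card T \<le> card (supp h - {i})"
    unfolding T_def by (intro card_mono) auto
  with h have T: "card T \<le> r" by simp
  have "vanishing C (insert i (S \<union> T)) = vanishing C (S \<union> T)"
    using h by (intro vanishing_dual_supp) (auto simp: T_def)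
  then have "vec.dim (vanishing C S) \<le> vec.dim (vanishing C (insert i (S \<union> T))) + card T"
    using dim_vanishing_Un[OF C, of S T] by simp
  moreover have "S \<inter> T = {}" "i \<notin> S \<union> T"
    using i by (auto simp: T_def)
  then have "card (insert i (S \<union> T)) = card S + card T + 1"
    by (simp add: card_Un_disjoint)
  ultimately show ?case
    using S T by (intro exI[of _ "insert i (S \<union> T)"]) simp
qed

lemma min_dist_le_card_supp:
  fixes C :: "(('a::{field,finite}) ^ 'n::finite) set"
  assumes "vec.subspace C" "x \<in> C" "x \<noteq> 0"
  shows "min_dist C \<le> card (supp x)"
  unfolding min_dist_def
proof (rule Min_le)
  let ?D = "{hamming_dist x y | x y. x \<in> C \<and> y \<in> C \<and> x \<noteq> y}"
  have "?D \<subseteq> {..CARD('n)}"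
    by (auto simp: hamming_dist_def intro: card_mono)
  then show "finite ?D"
    using finite_subset by blast
  have "card (supp x) = hamming_dist x 0"
    by (simp add: supp_def hamming_dist_def)
  then show "card (supp x) \<in> ?D"
    using assms vec.subspace_0 by blast
qed

text \<open>A nonzero codeword vanishing on \<open>S\<close> has weight at most
  \<open>n - card S\<close>. For a largest admissible \<open>S\<close> the remaining dimension is 1,
  so \<open>card S\<close> is at least \<open>k + t - 1\<close>.\<close>

lemma singleton_bound_locality:
  fixes C :: "(('a::{field,finite}) ^ 'n::finite) set"
  assumes C: "vec.subspace C" and r: "r > 0"
    and loc: "\<And>i. \<exists>h\<in>dual C. i \<in> supp h \<and> card (supp h) \<le> r + 1"
    and t: "t * r < vec.dim C"
  shows "min_dist C + vec.dim C + t \<le> CARD('n) + 1"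
proof -
  let ?P = "\<lambda>S. vec.dim C + t \<le> card S + vec.dim (vanishing C S) \<and> 0 < vec.dim (vanishing C S)"
  obtain S\<^sub>0 where "?P S\<^sub>0"
    using locality_vanishing[OF C r loc t] t by fastforce
  moreover have "card S < CARD('n) + 1" for S :: "'n set"
    by (simp add: card_mono less_Suc_eq_le)
  ultimately obtain S where S: "?P S" and max: "\<And>T. ?P T \<Longrightarrow> card T \<le> card S"
    using ex_has_greatest_nat[of ?P S\<^sub>0 card "CARD('n) + 1"] by blast
  obtain x :: "'a ^ 'n" and i where x: "x \<in> vanishing C S" "x $ i \<noteq> 0" and i: "i \<notin> S"
    using S exists_vanishing_coordinate by blast
  have insert_i: "card (insert i S) = card S + 1"
    using i by simp
  \<comment> \<open>Adding \<open>i\<close> gains one coordinate and loses at most one dimension, so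
    the inequality in \<open>?P\<close> survives. Maximality can therefore only break positivity,
    which forces dimension 1 before the insertion.\<close>
  then have "\<not> ?P (insert i S)"
    using max[of "insert i S"] by linarith
  with S insert_i dim_vanishing_insert[OF C, of S i] have "vec.dim (vanishing C S) = 1"
    by linarith
  moreover have "card (supp x) + card S \<le> CARD('n)"
  proof -
    have "card (supp x \<union> S) \<le> CARD('n)"
      by (intro card_mono) auto
    moreover have "supp x \<inter> S = {}"
      using x by (auto simp: supp_def vanishing_def)
    ultimately show ?thesis
      by (simp add: card_Un_disjoint)
  qed
  moreover have "min_dist C \<le> card (supp x)"
    using x by (intro min_dist_le_card_supp[OF C]) (auto simp: vanishing_def)
  ultimately show ?thesis
    using S by linarith
qed

lemma singleton_bound_locality_ceiling:
  fixes C :: "(('a::{field,finite}) ^ 'n::finite) set"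
  assumes C: "linear_code C k d" and r: "r > 0"
    and loc: "\<And>i. \<exists>h\<in>dual C. i \<in> supp h \<and> card (supp h) \<le> r + 1"
  shows "int d \<le> int CARD('n) - int k - \<lceil>real k / real r\<rceil> + 2"
proof -
  have k: "vec.dim C = k" "min_dist C = d" "vec.subspace C" "C \<noteq> {0}"
    using C by (auto simp: linear_code_def)
  then have "k > 0"
    using vec.subspace_0 by (metis bot_nat_0.not_eq_extremum empty_iff subset_singletonD vec.dim_eq_0)
  \<comment> \<open>This is the largest \<open>t\<close> with \<open>t * r < k\<close>. Since
    \<open>k > 0\<close>, the ceiling is at least 1 and \<open>nat\<close> truncates
    nothing.\<close>
  define t where "t = nat (\<lceil>real k / real r\<rceil> - 1)"
  have "\<lceil>real k / real r\<rceil> \<ge> 1"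
    using \<open>k > 0\<close> r by (simp add: less_ceiling_iff flip: zless_iff_Suc_zadd)
  then have t_int: "int t = \<lceil>real k / real r\<rceil> - 1"
    by (simp add: t_def)
  then have "real t < real k / real r"
    by linarith
  then have "real (t * r) < real k"
    using r by (simp add: field_simps)
  then have "t * r < vec.dim C"
    unfolding k by (simp only: of_nat_less_iff)
  from singleton_bound_locality[OF k(3) r loc this] show ?thesis
    unfolding k using t_int by linarith
qed

section \<open>The additive character of a finite field\<close>

lemma prime_CHAR: "prime CHAR('a::{field,finite})"
  by (intro prime_CHAR_semidom finite_imp_CHAR_pos) simp

text \<open>Multiplication by a nonzero \<open>x\<close> permutes the nonzero elements, so their
  product is unchanged when multiplied by \<open>x ^ (q - 1)\<close>.\<close>

lemma power_CARD_eq_self: "x ^ CARD('a) = (x :: 'a::{field,finite})"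
proof (cases "x = 0")
  case False
  let ?P = "\<Prod>(UNIV - {0 :: 'a})"
  have "?P = (\<Prod>y\<in>UNIV - {0}. x * y)"
    by (rule prod.reindex_bij_witness[of _ "\<lambda>y. x * y" "\<lambda>y. y / x"]) (use False in auto)
  also have "\<dots> = x ^ (CARD('a) - 1) * ?P"
    by (simp add: prod.distrib)
  finally have "x ^ (CARD('a) - 1) = 1"
    by simp
  moreover have "Suc (CARD('a) - 1) = CARD('a)"
    using zero_less_card_finite by simp
  ultimately show ?thesis
    by (metis mult.right_neutral power_Suc)
qed simp

lemma of_nat_mod_CHAR: "of_nat (t mod CHAR('a)) = (of_nat t :: 'a::comm_ring_1)"
  by (simp add: of_nat_eq_iff_cong_CHAR)

text \<open>A maximal additive subgroup of \<open>p\<close>-power order is the whole field: a missing element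
  would generate a \<open>p\<close> times larger one.\<close>

lemma CARD_eq_CHAR_power: "\<exists>m. CARD('a::{field,finite}) = CHAR('a) ^ m"
proof -
  let ?p = "CHAR('a)"
  let ?P = "\<lambda>G :: 'a set. 0 \<in> G \<and> (\<forall>x\<in>G. \<forall>y\<in>G. x + y \<in> G) \<and> (\<exists>m. card G = ?p ^ m)"
  have p: "prime ?p" by (rule prime_CHAR)
  have "?P {0}"
    by (auto intro: exI[of _ 0])
  moreover have "card G < CARD('a) + 1" for G :: "'a set"
    by (simp add: card_mono less_Suc_eq_le)
  ultimately obtain G where G: "?P G" and max: "\<And>H. ?P H \<Longrightarrow> card H \<le> card G"
    using ex_has_greatest_nat[of ?P "{0}" card "CARD('a) + 1"] by blast
  have mult_G: "of_nat k * g \<in> G" if "g \<in> G" for k g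
    using that G by (induction k) (auto simp: algebra_simps)
  have diff_G: "g - h \<in> G" if "g \<in> G" "h \<in> G" for g h
  proof -
    \<comment> \<open>Closure under addition already gives negatives, because \<open>- h\<close> is
      the \<open>(p - 1)\<close>-fold sum of \<open>h\<close>.\<close>
    have "(of_nat (?p - 1) :: 'a) = - 1"
      using prime_gt_0_nat[OF p] by (simp add: of_nat_diff)
    then have "- h \<in> G"
      using mult_G[of h "?p - 1"] that by simp
    then show ?thesis
      using G that by (metis add_uminus_conv_diff)
  qed
  have "x \<in> G" for x
  proof (rule ccontr)
    assume x: "x \<notin> G"
    define f where "f = (\<lambda>(t, g). of_nat t * x + g)"
    let ?H = "f ` ({..<?p} \<times> G)"
    \<comment> \<open>If \<open>t < u\<close>, then \<open>(u - t) x\<close> lies in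
      \<open>G\<close>; inverting \<open>u - t\<close> modulo \<open>p\<close> would put
      \<open>x\<close> itself into \<open>G\<close>.\<close>
    have f_eq: "t = u" if "f (t, g) = f (u, h)" "t \<le> u" "u < ?p" "g \<in> G" "h \<in> G" for t u g h
    proof (rule ccontr)
      assume "t \<noteq> u"
      with that have "coprime (u - t) ?p"
        using p by (metis coprime_commute diff_is_0_eq dvd_imp_le le_neq_implies_less
            less_imp_diff_less linorder_not_less prime_imp_coprime_nat zero_less_diff)
      then obtain k l where "(u - t) * k = ?p * l + 1"
        using coprime_bezout_strong[of "u - t" ?p] p by (metis not_prime_1)
      then have "of_nat ((u - t) * k) = (1 :: 'a)"
        by simp
      then have "x = of_nat k * (of_nat (u - t) * x)"
        by (metis mult.assoc mult.commute mult_1 of_nat_mult)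
      also have "of_nat (u - t) * x = g - h"
        using that by (simp add: f_def of_nat_diff algebra_simps)
      finally show False
        using x mult_G[OF diff_G[OF that(4,5)]] by metis
    qed
    have "inj_on f ({..<?p} \<times> G)"
    proof (rule inj_onI, clarify)
      fix t u g h
      assume *: "t < ?p" "g \<in> G" "u < ?p" "h \<in> G" "f (t, g) = f (u, h)"
      then have "t = u"
        using f_eq[of t g u h] f_eq[of u h t g] by (metis nat_le_linear)
      with * show "t = u \<and> g = h"
        by (simp add: f_def)
    qed
    then have card_H: "card ?H = ?p * card G"
      by (simp add: card_image card_cartesian_product)
    have "?P ?H"
    proof (intro conjI ballI)
      show "0 \<in> ?H"
        using G prime_gt_0_nat[OF p] by (intro image_eqI[of _ _ "(0, 0)"]) (auto simp: f_def)
      obtain m where "card G = ?p ^ m"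
        using G by blast
      then show "\<exists>m. card ?H = ?p ^ m"
        unfolding card_H by (intro exI[of _ "Suc m"]) simp
      fix y z assume "y \<in> ?H" "z \<in> ?H"
      then obtain t g u h where *: "y = f (t, g)" "g \<in> G" "z = f (u, h)" "h \<in> G"
        by auto
      have "y + z = f ((t + u) mod ?p, g + h)"
        by (simp add: * f_def of_nat_mod_CHAR algebra_simps)
      then show "y + z \<in> ?H"
        using * G prime_gt_0_nat[OF p] by (intro image_eqI[of _ _ "((t + u) mod ?p, g + h)"]) auto
    qed
    then have "?p * card G \<le> card G"
      using max[of ?H] card_H by simp
    moreover have "card G > 0"
      using G by (auto simp: card_gt_0_iff)
    ultimately show False
      using prime_gt_1_nat[OF p] by simp
  qed
  then have "G = UNIV" by auto
  with G show ?thesis by auto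
qed

lemma CARD_eq_CHAR_power_field_deg: "CARD('a) = CHAR('a) ^ field_deg TYPE('a::{field,finite})"
  unfolding field_deg_def
proof (rule theI')
  obtain m where "CARD('a) = CHAR('a) ^ m"
    using CARD_eq_CHAR_power by blast
  then show "\<exists>!m. CARD('a) = CHAR('a) ^ m"
    using prime_gt_1_nat[OF prime_CHAR[where 'a = 'a]] by auto
qed

text \<open>The polynomial \<open>X^p - X\<close> has at most \<open>p\<close> roots, and the
  \<open>p\<close> elements of the prime field are roots already.\<close>

lemma power_CHAR_eq_self_imp_of_nat:
  assumes "x ^ CHAR('a) = (x :: 'a::{field,finite})"
  shows "\<exists>t<CHAR('a). of_nat t = x"
proof -
  let ?p = "CHAR('a)" and ?R = "{y :: 'a. y ^ CHAR('a) = y}"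
  have p: "prime ?p" by (rule prime_CHAR)
  define f where "f = (monom 1 ?p - monom 1 1 :: 'a poly)"
  have "coeff f ?p = 1"
    using prime_gt_1_nat[OF p] by (simp add: f_def)
  then have "f \<noteq> 0" by auto
  have "degree f \<le> ?p"
    using prime_ge_1_nat[OF p] unfolding f_def
    by (intro degree_diff_le) (simp_all add: degree_monom_eq)
  with card_poly_roots_bound[OF \<open>f \<noteq> 0\<close>] have card_R: "card ?R \<le> ?p"
    by (simp add: f_def poly_monom)
  have sub: "of_nat ` {..<?p} \<subseteq> ?R"
  proof -
    have "(of_nat t :: 'a) ^ ?p = of_nat t" for t
      using prime_gt_0_nat[OF p] by (induction t) (simp_all add: freshmans_dream p)
    then show ?thesis by auto
  qed
  have "inj_on (of_nat :: nat \<Rightarrow> 'a) {..<?p}"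
    by (rule inj_onI) (metis lessThan_iff mod_less of_nat_eq_iff_cong_CHAR cong_def)
  then have "card (of_nat ` {..<?p} :: 'a set) = ?p"
    by (simp add: card_image)
  then have "of_nat ` {..<?p} = ?R"
    using sub card_R by (intro card_seteq) auto
  then have "x \<in> of_nat ` {..<?p}"
    using assms by simp
  then show ?thesis by auto
qed

section \<open>The trace to the prime field\<close>

lemma field_trace_add: "field_trace (x + y) = field_trace x + field_trace (y :: 'a::{field,finite})"
  by (simp add: field_trace_def freshmans_dream' prime_CHAR sum.distrib)

text \<open>The Frobenius map shifts the summands of the trace cyclically, since
  \<open>x ^ q = x\<close>. Hence the trace lies in the prime field, and the \<open>LEAST\<close> in
  \<open>add_char\<close> has a witness.\<close>

lemma field_trace_power_CHAR: "field_trace x ^ CHAR('a) = field_trace (x :: 'a::{field,finite})"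
proof -
  let ?m = "field_deg TYPE('a)" and ?f = "\<lambda>i. x ^ (CHAR('a) ^ i)"
  have "field_trace x ^ CHAR('a) = (\<Sum>i<?m. ?f (Suc i))"
    by (simp add: field_trace_def freshmans_dream_sum prime_CHAR mult.commute flip: power_mult)
  also have "\<dots> + ?f 0 = (\<Sum>i<Suc ?m. ?f i)"
    by (simp add: sum.lessThan_Suc_shift del: sum.lessThan_Suc)
  also have "\<dots> = field_trace x + ?f ?m"
    by (simp add: field_trace_def)
  also have "?f ?m = ?f 0"
    using power_CARD_eq_self[of x] by (simp flip: CARD_eq_CHAR_power_field_deg)
  finally show ?thesis by simp
qed

text \<open>The trace is a polynomial function of degree at most \<open>q / p\<close>, too small to
  vanish at all \<open>q\<close> elements.\<close>

lemma field_trace_nonzero: "\<exists>x :: 'a::{field,finite}. field_trace x \<noteq> 0"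
proof (rule ccontr)
  assume "\<not> ?thesis"
  then have zero: "field_trace x = 0" for x :: 'a by simp
  let ?m = "field_deg TYPE('a)" and ?p = "CHAR('a)"
  have p: "?p > 1" using prime_gt_1_nat[OF prime_CHAR] .
  have "?m \<noteq> 0"
    using CARD_eq_CHAR_power_field_deg[where 'a = 'a] one_less_card_field[where 'a = 'a]
    by (metis less_irrefl power_0)
  then obtain m where m: "?m = Suc m" by (metis not0_implies_Suc)
  define f where "f = (\<Sum>i<?m. monom 1 (?p ^ i) :: 'a poly)"
  \<comment> \<open>Only the summand \<open>i = 0\<close> contributes to the linear coefficient,
    which shows that \<open>f\<close> is not the zero polynomial.\<close>
  have "coeff f 1 = (\<Sum>i\<in>{0 :: nat}. 1)"
    unfolding f_def coeff_sum using p m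
    by (intro sum.mono_neutral_cong_right) auto
  then have "f \<noteq> 0" by auto
  have "degree f \<le> ?p ^ m"
    unfolding f_def using p m
    by (intro degree_sum_le) (auto intro!: order_trans[OF degree_monom_le] power_increasing)
  moreover have "{x. poly f x = 0} = UNIV"
    using zero by (simp add: f_def poly_sum poly_monom field_trace_def)
  ultimately have "CARD('a) \<le> ?p ^ m"
    using card_poly_roots_bound[OF \<open>f \<noteq> 0\<close>] by simp
  then show False
    using p m by (simp add: CARD_eq_CHAR_power_field_deg)
qed

section \<open>From the trace to a nontrivial additive character\<close>

lemma cis_root_of_unity_mod:
  fixes p t :: nat
  assumes "p > 0"
  shows "cis (2 * pi * real (t mod p) / real p) = cis (2 * pi * real t / real p)"
proof -
  have "real t = real p * real (t div p) + real (t mod p)"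
    by (metis mult_div_mod_eq of_nat_add of_nat_mult)
  then have "2 * pi * real t / real p = 2 * pi * real (t div p) + 2 * pi * real (t mod p) / real p"
    using assms by (simp add: field_simps)
  then show ?thesis
    by (simp flip: cis_mult)
qed

text \<open>Representatives of the trace agree modulo \<open>p\<close>, and the exponential has
  period \<open>p\<close>. Additivity needs this freedom, as the sum of two least representatives
  need not be least.\<close>

lemma add_char_eq:
  assumes "of_nat t = field_trace (x :: 'a::{field,finite})"
  shows "add_char x = cis (2 * pi * real t / real CHAR('a))"
proof -
  let ?l = "LEAST t. of_nat t = field_trace x"
  have "of_nat ?l = (of_nat t :: 'a)"
    unfolding assms by (rule LeastI[of _ t]) (rule assms)
  then have "?l mod CHAR('a) = t mod CHAR('a)"
    by (simp add: of_nat_eq_iff_cong_CHAR cong_def)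
  then show ?thesis
    unfolding add_char_def
    by (metis cis_root_of_unity_mod prime_gt_0_nat[OF prime_CHAR])
qed

lemma field_trace_of_nat:
  obtains t where "t < CHAR('a)" "of_nat t = field_trace (x :: 'a::{field,finite})"
  using power_CHAR_eq_self_imp_of_nat[OF field_trace_power_CHAR] by blast

lemma add_char_add: "add_char (x + y) = add_char x * add_char (y :: 'a::{field,finite})"
proof -
  obtain s t where "of_nat s = field_trace x" "of_nat t = field_trace y"
    using field_trace_of_nat by metis
  moreover from this have "of_nat (s + t) = field_trace (x + y)"
    by (simp add: field_trace_add)
  ultimately show ?thesis
    by (simp add: add_char_eq cis_mult add_divide_distrib distrib_left del: of_nat_add)
      (simp add: cis_mult add_divide_distrib distrib_left)
qed

lemma add_char_0 [simp]: "add_char (0 :: 'a::{field,finite}) = 1"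
proof -
  have "of_nat 0 = field_trace (0 :: 'a)"
    using field_trace_add[of "0 :: 'a" 0] by (simp only: add_cancel_right_right of_nat_0 add_0)
  from add_char_eq[OF this] show ?thesis by simp
qed

lemma add_char_sum: "add_char (\<Sum>i\<in>A. f i) = (\<Prod>i\<in>A. add_char (f i :: 'a::{field,finite}))"
  by (induction A rule: infinite_finite_induct) (simp_all add: add_char_add)

lemma add_char_nontrivial: "\<exists>x :: 'a::{field,finite}. add_char x \<noteq> 1"
proof -
  obtain x :: 'a where x: "field_trace x \<noteq> 0"
    using field_trace_nonzero by blast
  obtain t where t: "t < CHAR('a)" "of_nat t = field_trace x"
    using field_trace_of_nat by blast
  have p: "CHAR('a) > 0" by (rule prime_gt_0_nat[OF prime_CHAR])
  have "t \<noteq> 0"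
    using x t by (metis of_nat_0)
  then have "cis (2 * pi * real t / real CHAR('a)) \<noteq> cis (2 * pi * real 0 / real CHAR('a))"
    using bij_betw_imp_inj_on[OF Complex.bij_betw_roots_unity[OF p]] t(1) p by (metis inj_onD lessThan_iff)
  then show ?thesis
    by (intro exI[of _ x]) (simp add: add_char_eq[OF t(2)])
qed

text \<open>For nonzero \<open>s\<close> the products \<open>t * s\<close> exhaust the field, on
  which the character is nontrivial. This is how invariance under \<open>Z\<close>-type operators
  forces a syndrome to vanish.\<close>

lemma add_char_mult_eq_1_iff:
  "(\<forall>t. add_char (t * s) = 1) \<longleftrightarrow> s = (0 :: 'a::{field,finite})"
proof
  assume *: "\<forall>t. add_char (t * s) = 1"
  obtain x :: 'a where x: "add_char x \<noteq> 1"
    using add_char_nontrivial by blast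
  show "s = 0"
  proof (rule ccontr)
    assume "s \<noteq> 0"
    then show False
      using x *[rule_format, of "x / s"] by simp
  qed
qed simp

section \<open>Parity-check matrices\<close>

lemma dotp_add_right: "dotp x (y + z) = dotp x y + dotp x (z :: 'a::comm_ring_1 ^ 'n::finite)"
  by (simp add: dotp_def algebra_simps sum.distrib)

lemma dotp_diff_right: "dotp x (y - z) = dotp x y - dotp x (z :: 'a::comm_ring_1 ^ 'n::finite)"
  by (simp add: dotp_def algebra_simps sum_subtractf)

lemma dotp_commute: "dotp x y = dotp y (x :: 'a::comm_ring_1 ^ 'n::finite)"
  by (simp add: dotp_def mult.commute)

lemma dotp_row_comb: "dotp (row_comb m u H) x = (\<Sum>i<m. u i * dotp (H i) x)"
proof -
  have "dotp (row_comb m u H) x = (\<Sum>j\<in>UNIV. \<Sum>i<m. u i * (H i $ j * x $ j))"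
    by (simp add: dotp_def row_comb_def sum_distrib_right mult.assoc)
  also have "\<dots> = (\<Sum>i<m. u i * dotp (H i) x)"
    by (subst sum.swap) (simp add: dotp_def sum_distrib_left)
  finally show ?thesis .
qed

text \<open>Some linear functional takes the prescribed values on the independent rows; it is the
  dot product with the vector of its values at the unit vectors.\<close>

lemma ex_syndrome:
  fixes H :: "nat \<Rightarrow> 'a::field ^ 'n::finite"
  assumes "inj_on H {..<m}" "vec.independent (H ` {..<m})"
  shows "\<exists>x. \<forall>i<m. dotp (H i) x = s i"
proof -
  interpret vector_space_pair "(*s) :: 'a \<Rightarrow> 'a ^ 'n \<Rightarrow> 'a ^ 'n" "(*) :: 'a \<Rightarrow> 'a \<Rightarrow> 'a"
    by unfold_locales
  obtain g where g: "Vector_Spaces.linear (*s) (*) g"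
    and g_H: "\<forall>v\<in>H ` {..<m}. g v = s (the_inv_into {..<m} H v)"
    using linear_independent_extend[OF assms(2), of "\<lambda>v. s (the_inv_into {..<m} H v)"] by blast
  interpret g: Vector_Spaces.linear "(*s)" "(*)" g by (rule g)
  define x where "x = (\<chi> i. g (axis i 1))"
  have "dotp v x = g v" for v
  proof -
    have "g v = g (\<Sum>i\<in>UNIV. v $ i *s axis i 1)"
      by (simp add: basis_expansion)
    also have "\<dots> = dotp v x"
      by (simp add: g.sum g.scale x_def dotp_def)
    finally show ?thesis ..
  qed
  then show ?thesis
    using g_H assms(1) by (intro exI[of _ x]) (simp add: the_inv_into_f_f)
qed

lemma card_syndrome:
  fixes H :: "nat \<Rightarrow> 'a::{field,finite} ^ 'n::finite"
  assumes "parity_check_matrix m H C"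
  shows "card {x. \<forall>i<m. dotp (H i) x = s i} = card C"
proof -
  obtain z where z: "\<forall>i<m. dotp (H i) z = s i"
    using ex_syndrome[of H m s] assms by (auto simp: parity_check_matrix_def)
  have "{x. \<forall>i<m. dotp (H i) x = s i} = (+) z ` C"
  proof (intro equalityI subsetI)
    fix x assume "x \<in> {x. \<forall>i<m. dotp (H i) x = s i}"
    then show "x \<in> (+) z ` C"
      using assms z
      by (intro image_eqI[of _ _ "x - z"]) (auto simp: parity_check_matrix_def dotp_diff_right)
  qed (use assms z in \<open>auto simp: parity_check_matrix_def dotp_add_right\<close>)
  then show ?thesis
    by (simp add: card_image)
qed

text \<open>The \<open>q ^ m\<close> possible syndromes partition the whole space into classes, each
  a coset of \<open>C\<close>; the claim compares exponents of \<open>q\<close>.\<close>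

lemma dim_parity_check:
  fixes H :: "nat \<Rightarrow> 'a::{field,finite} ^ 'n::finite"
  assumes H: "parity_check_matrix m H C" and C: "vec.subspace C"
  shows "m + vec.dim C = CARD('n)"
proof -
  let ?U = "\<Pi>\<^sub>E i\<in>{..<m}. (UNIV :: 'a set)"
  let ?F = "\<lambda>s. {x. \<forall>i<m. dotp (H i) x = s i}"
  have "(UNIV :: ('a ^ 'n) set) = (\<Union>s\<in>?U. ?F s)"
  proof (intro equalityI subsetI)
    fix x :: "'a ^ 'n"
    show "x \<in> (\<Union>s\<in>?U. ?F s)"
      by (rule UN_I[of "restrict (\<lambda>i. dotp (H i) x) {..<m}"]) auto
  qed simp
  then have "CARD('a ^ 'n) = card (\<Union>s\<in>?U. ?F s)" by (rule arg_cong)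
  also have "\<dots> = (\<Sum>s\<in>?U. card (?F s))"
  proof (rule card_UN_disjoint; (intro ballI impI)?)
    fix s t assume "s \<in> ?U" "t \<in> ?U" "s \<noteq> t"
    then obtain i where "i < m" "s i \<noteq> t i"
      by (metis PiE_ext lessThan_iff)
    then show "?F s \<inter> ?F t = {}" by auto
  qed (auto intro: finite_PiE)
  also have "\<dots> = CARD('a) ^ m * CARD('a) ^ vec.dim C"
    by (simp add: card_syndrome[OF H] card_PiE card_subspace[OF C])
  finally have "CARD('a) ^ CARD('n) = CARD('a) ^ (m + vec.dim C)"
    using card_subspace[of "UNIV :: ('a ^ 'n) set"] by (simp add: vec_dim_card power_add)
  then show ?thesis
    using one_less_card_field[where 'a = 'a] by simp
qed

section \<open>Spaces of functions\<close>

lemma sum_fun_apply: "(\<Sum>i\<in>A. f i) x = (\<Sum>i\<in>A. f i x :: 'b::comm_monoid_add)"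
  by (induction A rule: infinite_finite_induct) simp_all

lemma mat_rank_le_rows: "mat_rank m m' M \<le> m"
proof -
  have "mat_rank m m' M \<le> card ((\<lambda>i j. if j < m' then M i j else 0) ` {..<m})"
    unfolding mat_rank_def fun_vs.dim_span by (rule fun_vs.dim_le_card') simp
  also have "\<dots> \<le> m"
    using card_image_le[of "{..<m}"] by simp
  finally show ?thesis .
qed

lemma mat_rank_le_cols:
  fixes M :: "nat \<Rightarrow> nat \<Rightarrow> 'k::field"
  shows "mat_rank m m' M \<le> m'"
proof -
  define e where "e = (\<lambda>j i :: nat. if i = j then 1 else 0 :: 'k)"
  have "(\<lambda>j. if j < m' then M i j else 0) \<in> fun_vs.span (e ` {..<m'})" for i
  proof -
    have "(\<lambda>j. if j < m' then M i j else 0) = (\<Sum>j<m'. fun_scale (M i j) (e j))"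
      by (auto simp: fun_eq_iff sum_fun_apply fun_scale_def e_def if_distrib cong: if_cong)
    also have "\<dots> \<in> fun_vs.span (e ` {..<m'})"
      by (intro fun_vs.span_sum fun_vs.span_scale fun_vs.span_base) auto
    finally show ?thesis .
  qed
  then have "mat_rank m m' M \<le> card (e ` {..<m'})"
    unfolding mat_rank_def fun_vs.dim_span by (intro fun_vs.dim_le_card) auto
  also have "\<dots> \<le> m'"
    using card_image_le[of "{..<m'}"] by simp
  finally show ?thesis .
qed

text \<open>The indicator functions of the cosets of \<open>A\<close> contained in \<open>S\<close> form a basis.\<close>

lemma dim_invariant_functions:
  fixes A S :: "'g::ab_group_add set"
  assumes A: "0 \<in> A" "\<And>a b. a \<in> A \<Longrightarrow> b \<in> A \<Longrightarrow> a - b \<in> A" and "finite S"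
    and S: "\<And>x a. x \<in> S \<Longrightarrow> a \<in> A \<Longrightarrow> x + a \<in> S"
  shows "fun_vs.dim {\<psi> :: 'g \<Rightarrow> 'k::field. (\<forall>x. x \<notin> S \<longrightarrow> \<psi> x = 0) \<and>
    (\<forall>a\<in>A. \<forall>x. \<psi> (x - a) = \<psi> x)} * card A = card S"
    (is "fun_vs.dim ?Q * _ = _")
proof -
  define coset where "coset = (\<lambda>x. (+) x ` A)"
  define ind where "ind = (\<lambda>(T :: 'g set) x. if x \<in> T then 1 else 0 :: 'k)"
  let ?K = "coset ` S" and ?B = "ind ` coset ` S"
  have minus: "- a \<in> A" if "a \<in> A" for a
    using A(2)[OF A(1) that] by simp
  have plus: "a + b \<in> A" if "a \<in> A" "b \<in> A" for a b
    using A(2)[OF that(1) minus[OF that(2)]] by simp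
  have mem_coset: "x \<in> coset y \<longleftrightarrow> x - y \<in> A" for x y
    unfolding coset_def by (auto intro: image_eqI[of _ _ "x - y"])
  have self: "x \<in> coset x" for x
    by (simp add: mem_coset A)
  have coset_eq: "coset x = coset y" if "x \<in> coset y" for x y
  proof (intro set_eqI)
    fix z
    have "z - y = (z - x) + (x - y)" "z - x = (z - y) - (x - y)" by simp_all
    then show "z \<in> coset x \<longleftrightarrow> z \<in> coset y"
      using that plus A(2) unfolding mem_coset by metis
  qed
  have coset_sub: "coset x \<subseteq> S" if "x \<in> S" for x
    using S that by (auto simp: coset_def)
  have inj_ind: "inj ind"
    unfolding ind_def by (rule injI) (metis (mono_tags) set_eqI zero_neq_one)
  \<comment> \<open>At each point of \<open>S\<close> exactly one basis function is nonzero.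
    Evaluating a combination at \<open>x\<close> thus reads off one coefficient, which serves both
    spanning and independence.\<close>
  have ind_eq: "b x = (if b = ind (coset x) then 1 else 0)" if B: "b \<in> ?B" for b x
  proof -
    obtain y where b: "b = ind (coset y)"
      using B by blast
    show ?thesis
      using coset_eq[of x y] self[of x] injD[OF inj_ind, of "coset y" "coset x"]
      by (auto simp: b ind_def)
  qed
  have in_B: "ind (coset x) \<in> ?B \<longleftrightarrow> x \<in> S" for x
    using inj_ind coset_sub self by (auto dest!: injD[OF inj_ind])
  have [simp]: "finite ?B"
    using assms by simp
  have expand: "(\<Sum>b\<in>?B. fun_scale (c b) b) x = (if x \<in> S then c (ind (coset x)) else 0)"
    for c x
  proof -
    have "(\<Sum>b\<in>?B. fun_scale (c b) b) x = (\<Sum>b\<in>?B. if b = ind (coset x) then c b else 0)"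
      unfolding sum_fun_apply by (rule sum.cong) (auto simp: fun_scale_def ind_eq)
    then show ?thesis
      by (simp add: in_B)
  qed
  have sub: "?B \<subseteq> ?Q"
  proof clarsimp
    fix y assume y: "y \<in> S"
    have "x - a \<in> coset y \<longleftrightarrow> x \<in> coset y" if "a \<in> A" for a x
    proof -
      have "x - a - y = (x - y) - a" "x - y = (x - a - y) + a" by simp_all
      then show ?thesis
        using A(2) plus that unfolding mem_coset by metis
    qed
    then show "(\<forall>x. x \<notin> S \<longrightarrow> ind (coset y) x = 0) \<and>
        (\<forall>a\<in>A. \<forall>x. ind (coset y) (x - a) = ind (coset y) x)"
      using coset_sub[OF y] by (auto simp: ind_def)
  qed
  have span: "?Q \<subseteq> fun_vs.span ?B"
  proof
    fix \<psi> assume \<psi>: "\<psi> \<in> ?Q"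
    \<comment> \<open>The coefficient of a coset indicator is the value of \<open>\<psi>\<close> at
      some representative; by invariance the choice is immaterial.\<close>
    define c where "c = (\<lambda>b. \<psi> (SOME x. b x = (1 :: 'k)))"
    have "\<psi> x = (\<Sum>b\<in>?B. fun_scale (c b) b) x" for x
    proof (cases "x \<in> S")
      case True
      let ?y = "SOME y. ind (coset x) y = (1 :: 'k)"
      have "ind (coset x) ?y = (1 :: 'k)"
        by (rule someI[of _ x]) (simp add: ind_def self)
      then have "?y - x \<in> A"
        by (simp add: ind_def mem_coset split: if_splits)
      then have "\<psi> (?y - (?y - x)) = \<psi> ?y"
        using \<psi> by blast
      then show ?thesis
        using True by (simp add: expand c_def)
    qed (use \<psi> in \<open>simp add: expand\<close>)
    then have "\<psi> = (\<Sum>b\<in>?B. fun_scale (c b) b)" by blast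
    also have "\<dots> \<in> fun_vs.span ?B"
      by (intro fun_vs.span_sum fun_vs.span_scale fun_vs.span_base) auto
    finally show "\<psi> \<in> fun_vs.span ?B" .
  qed
  have indep: "fun_vs.independent ?B"
  proof (rule fun_vs.independent_if_scalars_zero)
    fix c b assume *: "(\<Sum>b\<in>?B. fun_scale (c b) b) = 0" and "b \<in> ?B"
    then obtain x where "x \<in> S" "b = ind (coset x)" by blast
    then show "c b = 0"
      using fun_cong[OF *, of x] by (simp add: expand)
  qed simp
  have "fun_vs.dim ?Q = card ?B"
    using fun_vs.dim_unique[OF sub span indep refl] .
  also have "\<dots> = card ?K"
    using inj_ind by (intro card_image) (auto intro: inj_on_subset)
  finally have "fun_vs.dim ?Q = card ?K" .
  moreover have "card A * card ?K = card (\<Union>?K)"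
  proof (rule card_partition)
    show "finite (\<Union>?K)"
      using coset_sub assms(3) by (meson UN_least finite_subset)
    show "card T = card A" if "T \<in> ?K" for T
      using that by (auto simp: coset_def card_image)
    show "T \<inter> U = {}" if "T \<in> ?K" "U \<in> ?K" "T \<noteq> U" for T U
      using that coset_eq by blast
  qed (use assms in simp)
  moreover have "\<Union>?K = S"
    using coset_sub self by blast
  ultimately show ?thesis
    by (simp add: mult.commute)
qed

section \<open>The number of logical qudits\<close>

text \<open>These are the basis labels of the receiver register, identified with tuples of length
  \<open>c\<close> padded by 0.\<close>

lemma card_finitely_supported:
  "finite {y :: nat \<Rightarrow> 'a::{zero,finite}. \<forall>j\<ge>c. y j = 0} \<and>
   card {y :: nat \<Rightarrow> 'a. \<forall>j\<ge>c. y j = 0} = CARD('a) ^ c"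
proof -
  let ?U = "\<Pi>\<^sub>E j\<in>{..<c}. (UNIV :: 'a set)" and ?f = "\<lambda>y j. if j < c then y j else (0 :: 'a)"
  have "{y :: nat \<Rightarrow> 'a. \<forall>j\<ge>c. y j = 0} = ?f ` ?U"
  proof (intro equalityI subsetI)
    fix y :: "nat \<Rightarrow> 'a" assume "y \<in> {y. \<forall>j\<ge>c. y j = 0}"
    then show "y \<in> ?f ` ?U"
      by (intro image_eqI[of _ _ "restrict y {..<c}"]) auto
  next
    fix y assume "y \<in> ?f ` ?U"
    then obtain z where "y = ?f z" by blast
    then show "y \<in> {y. \<forall>j\<ge>c. y j = 0}" by simp
  qed
  moreover have "inj_on ?f ?U"
  proof (rule inj_onI)
    fix y z assume yz: "y \<in> ?U" "z \<in> ?U" and eq: "?f y = ?f z"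
    show "y = z"
    proof (rule PiE_ext[OF yz])
      fix j assume "j \<in> {..<c}"
      then show "y j = z j"
        using fun_cong[OF eq, of j] by simp
    qed
  qed
  ultimately show ?thesis
    by (simp add: card_image card_PiE finite_PiE)
qed

lemma row_comb_0 [simp]: "row_comb m (\<lambda>_. 0) (H :: nat \<Rightarrow> 'a::{field,finite} ^ 'n::finite) = 0"
  by (simp add: row_comb_def)

lemma row_comb_B_0 [simp]: "row_comb_B m c (\<lambda>_. 0) G = (0 :: nat \<Rightarrow> 'a::{field,finite})"
  by (auto simp: row_comb_B_def fun_eq_iff)

lemma row_comb_diff:
  "row_comb m u H - row_comb m v H = row_comb m (\<lambda>i. u i - v i) (H :: nat \<Rightarrow> 'a::{field,finite} ^ 'n::finite)"
  by (simp add: row_comb_def vec.scale_left_diff_distrib sum_subtractf)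

lemma row_comb_B_diff:
  "row_comb_B m c u G - row_comb_B m c v G =
   row_comb_B m c (\<lambda>i. u i - v i) (G :: nat \<Rightarrow> nat \<Rightarrow> 'a::{field,finite})"
  by (auto simp: row_comb_B_def fun_eq_iff left_diff_distrib sum_subtractf)

section \<open>The stabilized space for fixed parity-check matrices and a fixed rank
  factorization\<close>

context
  fixes C_X C_Z :: "(('a::{field,finite}) ^ 'n::finite) set"
    and m_X m_Z c :: nat
    and H_X H_Z :: "nat \<Rightarrow> 'a ^ 'n"
    and F_X F_Z :: "nat \<Rightarrow> nat \<Rightarrow> 'a"
  assumes H_X: "parity_check_matrix m_X H_X C_X"
    and H_Z: "parity_check_matrix m_Z H_Z C_Z"
    and F: "rank_factorization m_X m_Z c (\<lambda>i j. - dotp (H_X i) (H_Z j)) F_X F_Z"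
begin

definition translation_group :: "(('a ^ 'n) \<times> (nat \<Rightarrow> 'a)) set" where
  "translation_group = range (\<lambda>u. (row_comb m_X u H_X, row_comb_B m_X c u F_X))"

text \<open>The argument of the character by which the \<open>j\<close>-th \<open>Z\<close>-type
  generator acts on the basis state labelled \<open>(x, y)\<close>.\<close>

definition syndrome :: "nat \<Rightarrow> 'a ^ 'n \<Rightarrow> (nat \<Rightarrow> 'a) \<Rightarrow> 'a" where
  "syndrome j x y = dotp (H_Z j) x + (\<Sum>l<c. F_Z j l * y l)"

definition syndrome_free :: "(('a ^ 'n) \<times> (nat \<Rightarrow> 'a)) set" where
  "syndrome_free = {(x, y). (\<forall>j\<ge>c. y j = 0) \<and> (\<forall>j<m_Z. syndrome j x y = 0)}"

lemma translation_group_0: "0 \<in> translation_group"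
  unfolding translation_group_def
  by (rule image_eqI[of _ _ "\<lambda>_. 0"]) (simp_all add: zero_prod_def)

lemma translation_group_diff:
  assumes "a \<in> translation_group" "b \<in> translation_group"
  shows "a - b \<in> translation_group"
  using assms unfolding translation_group_def
  by (auto simp: row_comb_diff row_comb_B_diff)

text \<open>The transmitted part contributes an entry of \<open>H_X H_Z^T\<close>, combined over the
  rows by \<open>u\<close>, and the receiver part the same combination of
  \<open>F_X F_Z^T = - H_X H_Z^T\<close>. Their cancellation expresses that \<open>X\<close>-type
  and \<open>Z\<close>-type stabilizers commute.\<close>

lemma syndrome_translation:
  assumes "j < m_Z"
  shows "syndrome j (row_comb m_X u H_X) (row_comb_B m_X c u F_X) = 0"
proof -
  have "(\<Sum>l<c. F_Z j l * row_comb_B m_X c u F_X l) =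
      (\<Sum>l<c. \<Sum>i<m_X. u i * (F_X i l * F_Z j l))"
    by (simp add: row_comb_B_def sum_distrib_left mult_ac)
  also have "\<dots> = (\<Sum>i<m_X. u i * (\<Sum>l<c. F_X i l * F_Z j l))"
    by (subst sum.swap) (simp add: sum_distrib_left)
  also have "\<dots> = (\<Sum>i<m_X. u i * - dotp (H_X i) (H_Z j))"
    using F assms by (intro sum.cong) (auto simp: rank_factorization_def)
  also have "\<dots> = - dotp (H_Z j) (row_comb m_X u H_X)"
    by (subst dotp_commute) (simp add: dotp_row_comb sum_negf)
  finally show ?thesis
    by (simp add: syndrome_def)
qed

lemma syndrome_free_translation:
  assumes "p \<in> syndrome_free" "a \<in> translation_group"
  shows "p + a \<in> syndrome_free"
proof -
  obtain x y u where "p = (x, y)" and a: "a = (row_comb m_X u H_X, row_comb_B m_X c u F_X)"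
    using assms(2) by (cases p) (auto simp: translation_group_def)
  moreover have "syndrome j (x + x') (y + y') = syndrome j x y + syndrome j x' y'" for j x' y'
    by (simp add: syndrome_def dotp_add_right distrib_left sum.distrib)
  ultimately show ?thesis
    using assms(1) syndrome_translation
    by (auto simp: syndrome_free_def row_comb_B_def)
qed

lemma card_translation_group: "card translation_group = CARD('a) ^ m_X"
proof -
  let ?U = "\<Pi>\<^sub>E i\<in>{..<m_X}. (UNIV :: 'a set)"
  let ?f = "\<lambda>u. (row_comb m_X u H_X, row_comb_B m_X c u F_X)"
  have "translation_group = ?f ` ?U"
  proof -
    have "?f u = ?f (restrict u {..<m_X})" for u
      by (simp add: row_comb_def row_comb_B_def fun_eq_iff)
    then have "?f u \<in> ?f ` ?U" for u
      by (intro image_eqI[of _ _ "restrict u {..<m_X}"]) auto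
    then show ?thesis
      unfolding translation_group_def by blast
  qed
  moreover have "inj_on ?f ?U"
  proof (rule inj_onI)
    fix u v assume uv: "u \<in> ?U" "v \<in> ?U" and eq: "?f u = ?f v"
    show "u = v"
    proof (rule PiE_ext[OF uv])
      fix i assume i: "i \<in> {..<m_X}"
      \<comment> \<open>A vector dual to row \<open>i\<close> of \<open>H_X\<close>: its dot product
        with \<open>u H_X\<close> recovers \<open>u i\<close>, so the transmitted component alone
        gives injectivity.\<close>
      obtain x where x: "\<forall>k<m_X. dotp (H_X k) x = (if k = i then 1 else 0)"
        using ex_syndrome[of H_X m_X "\<lambda>k. if k = i then 1 else 0"] H_X
        by (auto simp: parity_check_matrix_def)
      have "dotp (row_comb m_X w H_X) x = w i" for w
      proof -
        have "dotp (row_comb m_X w H_X) x = (\<Sum>k<m_X. if k = i then w k else 0)"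
          unfolding dotp_row_comb using x by (intro sum.cong) auto
        then show ?thesis
          using i by simp
      qed
      then show "u i = v i"
        using eq by (metis prod.inject)
    qed
  qed
  ultimately show ?thesis
    by (simp add: card_image card_PiE)
qed

text \<open>Each of the \<open>q ^ c\<close> receiver labels \<open>y\<close> prescribes the
  syndrome \<open>- F_Z y\<close> for \<open>x\<close>, whose solutions form a coset of
  \<open>C_Z\<close>.\<close>

lemma card_syndrome_free: "finite syndrome_free \<and> card syndrome_free = CARD('a) ^ c * card C_Z"
proof -
  let ?Y = "{y :: nat \<Rightarrow> 'a. \<forall>j\<ge>c. y j = 0}"
  let ?F = "\<lambda>y. {x. \<forall>j<m_Z. dotp (H_Z j) x = - (\<Sum>l<c. F_Z j l * y l)}"
  have "syndrome_free = (\<lambda>(y, x). (x, y)) ` (SIGMA y:?Y. ?F y)"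
    by (auto simp: syndrome_free_def syndrome_def eq_neg_iff_add_eq_0 image_iff)
  moreover have "inj_on (\<lambda>(y, x). (x, y)) (SIGMA y:?Y. ?F y)"
    by (auto intro: inj_onI)
  ultimately show ?thesis
    using card_finitely_supported[where 'a = 'a, of c]
    by (simp add: card_image card_syndrome[OF H_Z])
qed

lemma Z_op_row_comb:
  "Z_op c (row_comb m_Z v H_Z) (row_comb_B m_Z c v F_Z) \<psi> (x, y) =
   add_char (\<Sum>j<m_Z. v j * syndrome j x y) * \<psi> (x, y)"
proof -
  have "(\<Sum>l<c. row_comb_B m_Z c v F_Z l * y l) = (\<Sum>l<c. \<Sum>j<m_Z. v j * (F_Z j l * y l))"
    by (simp add: row_comb_B_def sum_distrib_right mult.assoc)
  also have "\<dots> = (\<Sum>j<m_Z. v j * (\<Sum>l<c. F_Z j l * y l))"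
    by (subst sum.swap) (simp add: sum_distrib_left)
  finally have "dotp (row_comb m_Z v H_Z) x + (\<Sum>l<c. row_comb_B m_Z c v F_Z l * y l) =
      (\<Sum>j<m_Z. v j * syndrome j x y)"
    by (simp add: dotp_row_comb syndrome_def distrib_left sum.distrib)
  then show ?thesis
    by (simp add: Z_op_def dotp_def flip: add_char_sum add_char_add)
qed

lemma stabilized_space_eq:
  "stabilized_space m_X m_Z c H_X H_Z F_X F_Z =
   {\<psi>. (\<forall>p. p \<notin> syndrome_free \<longrightarrow> \<psi> p = 0) \<and> (\<forall>a\<in>translation_group. \<forall>p. \<psi> (p - a) = \<psi> p)}"
  (is "?L = ?R")
proof (intro equalityI subsetI)
  fix \<psi> assume \<psi>: "\<psi> \<in> ?L"
  \<comment> \<open>Below, \<open>v = 0\<close> isolates the \<open>X\<close>-type operators and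
    \<open>u = 0\<close> the \<open>Z\<close>-type ones.\<close>
  then have stab: "X_op (row_comb m_X u H_X) (row_comb_B m_X c u F_X)
      (Z_op c (row_comb m_Z v H_Z) (row_comb_B m_Z c v F_Z) \<psi>) (x, y) = \<psi> (x, y)" for u v x y
    by (simp add: stabilized_space_def)
  have "\<psi> (p - a) = \<psi> p" if "a \<in> translation_group" for a p
  proof -
    obtain u where "a = (row_comb m_X u H_X, row_comb_B m_X c u F_X)"
      using \<open>a \<in> translation_group\<close> by (auto simp: translation_group_def)
    then show ?thesis
      using stab[of u "\<lambda>_. 0" "fst p" "snd p"] by (cases p) (simp add: X_op_def Z_op_def)
  qed
  moreover have "\<psi> (x, y) = 0" if "(x, y) \<notin> syndrome_free" for x y
  proof (rule ccontr)
    assume nz: "\<psi> (x, y) \<noteq> 0"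
    then have "\<forall>j\<ge>c. y j = 0"
      using \<psi> by (auto simp: stabilized_space_def states_def)
    with that obtain j where j: "j < m_Z" "syndrome j x y \<noteq> 0"
      by (auto simp: syndrome_free_def)
    then obtain t where t: "add_char (t * syndrome j x y) \<noteq> 1"
      using add_char_mult_eq_1_iff by blast
    have "X_op 0 0 \<phi> = \<phi>" for \<phi> :: "('a, 'n) state"
      by (auto simp: X_op_def fun_eq_iff)
    \<comment> \<open>The choice of \<open>v\<close> as \<open>t\<close> at \<open>j\<close> and 0
      elsewhere singles out the nonzero syndrome entry, giving an eigenvalue other than 1.\<close>
    then have "add_char (\<Sum>k<m_Z. (if k = j then t else 0) * syndrome k x y) * \<psi> (x, y) = \<psi> (x, y)"
      using stab[of "\<lambda>_. 0" "\<lambda>k. if k = j then t else 0" x y]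
      by (simp only: row_comb_0 row_comb_B_0 Z_op_row_comb)
    with nz t j show False
      by (simp add: if_distrib[of "\<lambda>z. z * _"] cong: if_cong)
  qed
  ultimately show "\<psi> \<in> ?R" by auto
next
  fix \<psi> assume \<psi>: "\<psi> \<in> ?R"
  then have "\<psi> \<in> states c"
    by (auto simp: states_def syndrome_free_def)
  moreover have "Z_op c (row_comb m_Z v H_Z) (row_comb_B m_Z c v F_Z) \<psi> = \<psi>" for v
  proof
    fix p show "Z_op c (row_comb m_Z v H_Z) (row_comb_B m_Z c v F_Z) \<psi> p = \<psi> p"
    proof (cases p)
      case (Pair x y)
      then show ?thesis
        using \<psi> by (cases "p \<in> syndrome_free") (auto simp: Z_op_row_comb syndrome_free_def)
    qed
  qed
  moreover have "X_op (row_comb m_X u H_X) (row_comb_B m_X c u F_X) \<psi> = \<psi>" for u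
  proof
    fix p
    have "(row_comb m_X u H_X, row_comb_B m_X c u F_X) \<in> translation_group"
      by (auto simp: translation_group_def)
    then have "\<psi> (p - (row_comb m_X u H_X, row_comb_B m_X c u F_X)) = \<psi> p"
      using \<psi> by blast
    then show "X_op (row_comb m_X u H_X) (row_comb_B m_X c u F_X) \<psi> p = \<psi> p"
      by (cases p) (simp add: X_op_def)
  qed
  ultimately show "\<psi> \<in> ?L"
    by (simp add: stabilized_space_def)
qed

lemma dim_stabilized_space:
  "fun_vs.dim (stabilized_space m_X m_Z c H_X H_Z F_X F_Z) * CARD('a) ^ m_X =
   CARD('a) ^ c * card C_Z"
  using dim_invariant_functions[of translation_group syndrome_free, where 'k = complex]
    translation_group_0 translation_group_diff syndrome_free_translation
    card_translation_group card_syndrome_free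
  by (simp add: stabilized_space_eq)

end

text \<open>Comparing exponents in the dimension count gives
  \<open>\<kappa> + m_X = c + k_Z\<close>, where \<open>m_X = n - k_X\<close>.\<close>

lemma ea_css_code_logical_qudits:
  fixes C_X C_Z :: "(('a::{field,finite}) ^ 'n::finite) set"
  assumes C_X: "vec.subspace C_X" and C_Z: "vec.subspace C_Z"
    and Q: "ea_css_code C_X C_Z c Q" "fun_vs.dim Q = CARD('a) ^ \<kappa>"
  shows "\<kappa> + CARD('n) = vec.dim C_X + vec.dim C_Z + c"
    and "\<kappa> \<le> vec.dim C_X" and "\<kappa> \<le> vec.dim C_Z"
proof -
  obtain m_X m_Z H_X H_Z F_X F_Z where
    H_X: "parity_check_matrix m_X H_X C_X" and H_Z: "parity_check_matrix m_Z H_Z C_Z" and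
    F: "rank_factorization m_X m_Z c (\<lambda>i j. - dotp (H_X i) (H_Z j)) F_X F_Z" and
    "Q = stabilized_space m_X m_Z c H_X H_Z F_X F_Z"
    using Q(1) unfolding ea_css_code_def by blast
  then have "CARD('a) ^ (\<kappa> + m_X) = CARD('a) ^ (c + vec.dim C_Z)"
    using dim_stabilized_space[OF H_X H_Z F] Q(2) C_Z by (simp add: power_add card_subspace)
  then have "\<kappa> + m_X = c + vec.dim C_Z"
    using one_less_card_field[where 'a = 'a] by simp
  moreover have "m_X + vec.dim C_X = CARD('n)" "m_Z + vec.dim C_Z = CARD('n)"
    using dim_parity_check H_X H_Z C_X C_Z by blast+
  \<comment> \<open>The two bounds act crosswise: \<open>c \<le> n - k_Z\<close> yields
    \<open>\<kappa> \<le> k_X\<close>, and \<open>c \<le> n - k_X\<close> yields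
    \<open>\<kappa> \<le> k_Z\<close>.\<close>
  moreover have "c \<le> m_X" "c \<le> m_Z"
    using F mat_rank_le_rows mat_rank_le_cols unfolding rank_factorization_def by metis+
  ultimately show "\<kappa> + CARD('n) = vec.dim C_X + vec.dim C_Z + c"
    "\<kappa> \<le> vec.dim C_X" "\<kappa> \<le> vec.dim C_Z"
    by linarith+
qed

theorem theorem5:
  fixes C_X C_Z :: "(('a::{field,finite}) ^ 'n::finite) set"
    and Q :: "('a, 'n) state set"
    and n r k_X d_X k_Z d_Z \<kappa> \<delta> c :: nat
  assumes n: "n = CARD('n)"
    and r: "r > 0"
    and C_X: "linear_code C_X k_X d_X"
    and C_Z: "linear_code C_Z k_Z d_Z"
    and locality: "css_locality r C_X C_Z"
    and Q: "ea_css_code_params C_X C_Z Q \<kappa> \<delta> c"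
    and pure: "\<delta> = min d_X d_Z"
  shows "2 * int \<delta> = int n + int c - int \<kappa> - 2 * \<lceil>real \<kappa> / real r\<rceil> + 4 \<longleftrightarrow>
    (k_X = k_Z \<and> d_X = d_Z) \<and>
    (int d_X = int n - int k_X - \<lceil>real k_X / real r\<rceil> + 2 \<and>
     int d_Z = int n - int k_Z - \<lceil>real k_Z / real r\<rceil> + 2) \<and>
    (\<lceil>real k_X / real r\<rceil> = \<lceil>real k_Z / real r\<rceil> \<and>
     \<lceil>real k_Z / real r\<rceil> = \<lceil>real \<kappa> / real r\<rceil>)"
proof -
  have "vec.subspace C_X" "vec.dim C_X = k_X" "vec.subspace C_Z" "vec.dim C_Z = k_Z"
    using C_X C_Z by (auto simp: linear_code_def)
  then have \<kappa>: "\<kappa> + n = k_X + k_Z + c" "\<kappa> \<le> k_X" "\<kappa> \<le> k_Z"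
    using ea_css_code_logical_qudits[of C_X C_Z c Q \<kappa>] Q n by (auto simp: ea_css_code_params_def)
  then have ceiling: "\<lceil>real \<kappa> / real r\<rceil> \<le> \<lceil>real k_X / real r\<rceil>"
      "\<lceil>real \<kappa> / real r\<rceil> \<le> \<lceil>real k_Z / real r\<rceil>"
    by (auto intro!: ceiling_mono divide_right_mono)
  have loc: "\<exists>h\<in>dual C_X. i \<in> supp h \<and> card (supp h) \<le> r + 1"
      "\<exists>h\<in>dual C_Z. i \<in> supp h \<and> card (supp h) \<le> r + 1" for i
  proof -
    obtain h_X h_Z where h: "h_X \<in> dual C_X" "h_Z \<in> dual C_Z" "i \<in> supp h_X \<inter> supp h_Z"
        "card (supp h_X \<union> supp h_Z) \<le> r + 1"
      using locality unfolding css_locality_def by blast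
    moreover have "card (supp h_X) \<le> card (supp h_X \<union> supp h_Z)"
        "card (supp h_Z) \<le> card (supp h_X \<union> supp h_Z)"
      by (auto intro: card_mono)
    ultimately show "\<exists>h\<in>dual C_X. i \<in> supp h \<and> card (supp h) \<le> r + 1"
        "\<exists>h\<in>dual C_Z. i \<in> supp h \<and> card (supp h) \<le> r + 1"
      by (meson IntD1 IntD2 le_trans)+
  qed
  have bound: "int d_X \<le> int n - int k_X - \<lceil>real k_X / real r\<rceil> + 2"
      "int d_Z \<le> int n - int k_Z - \<lceil>real k_Z / real r\<rceil> + 2"
    using singleton_bound_locality_ceiling[OF C_X r loc(1)]
      singleton_bound_locality_ceiling[OF C_Z r loc(2)] n by auto
  \<comment> \<open>Here \<open>n + c - \<kappa> = 2 n - k_X - k_Z\<close>. Equality forces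
    \<open>d_X = d_Z\<close>, tightness of both classical bounds and equality of all three ceilings;
    \<open>k_X = k_Z\<close> then follows by comparing the two tight bounds.\<close>
  show ?thesis
    using \<kappa> ceiling bound pure by linarith
qed

end
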